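(* Let $\mathbb{F}$ be a field of characteristic $0$ and let $\big(g(x),F(x)\big)\in\mathcal{R}(\mathbb{F})$, where $g(x)$ has constant term $g_0$; set $\widehat{g}(x)=\frac1{g_0}g(x)$. (a) If $\big(g(x),F(x)\big)$ has finite order and $b$ is the order of $F(x)$ in $\mathbb{F}_1[[x]]$, then $$h(x)=\Big(\widehat{g}^{\frac1b}(x)\Big)^{b-1}\Big(\widehat{g}^{\frac1b}\big(F(x)\big)\Big)^{b-2}\Big(\widehat{g}^{\frac1b}\big(F^{(2)}(x)\big)\Big)^{b-3}\cdots\Big(\widehat{g}^{\frac1b}\big(F^{(b-2)}(x)\big)\Big)$$ is the generating function of an eigenvector of $\big(g(x),F(x)\big)$ with eigenvalue $g_0$. (b) In particular, if $\big(g(x),F(x)\big)$ is an involution in $\mathcal{R}(\mathbb{F})$, then $h(x)=\sqrt{\widehat{g}(x)}$ is the generating function of an eigenvector of $\big(g(x),F(x)\big)$ with eigenvalue $g_0$.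
   Context: $\mathbb{F}_0[[x]]$ is the group, under multiplication, of formal power series over $\mathbb{F}$ with nonzero constant term. $\mathbb{F}_1[[x]]$ is the group, under composition, of formal power series $f_1x+f_2x^2+\cdots$ over $\mathbb{F}$ with $f_1\ne0$. $F^{(m)}$ denotes the $m$-fold composite of $F$ with itself ($F^{(0)}(x)=x$). The Riordan group $\mathcal{R}(\mathbb{F})$ is the set $\mathbb{F}_0[[x]]\times\mathbb{F}_1[[x]]$ with operation $\big(g(x),F(x)\big)\big(h(x),K(x)\big)=\big(g(x)\cdot h(F(x)),\,K(F(x))\big)$ and identity $(1,x)$. The order of a group element is the least positive integer $n$ for which its $n$-th power is the identity; an involution is an element of order two. An element $\big(g(x),F(x)\big)$ is identified with the infinite lower triangular matrix $[d_{n,j}]_{n,j\ge0}$ over $\mathbb{F}$ with $d_{n,j}=[x^n]\,g(x)F(x)^j$, acting on column vectors $\vec v=(v_0,v_1,\ldots)^T$ with entries in $\mathbb{F}$; the generating function of $\vec v$ is $\sum_{n\ge0}v_nx^n$. For a series $u(x)=1+b_1x+\cdots$ and a positive integer $m$, $u^{\frac1m}(x)$ denotes the unique $m$-th root of $u(x)$ of the form $1+c_1x+\cdots$, and $\sqrt{u(x)}=u^{\frac12}(x)$. The product defining $h(x)$ is $\prod_{i=0}^{b-2}\big(\widehat{g}^{\frac1b}(F^{(i)}(x))\big)^{b-1-i}$, which is the empty product $1$ when $b=1$. *)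

theory Defs
  imports
    "HOL-Algebra.Multiplicative_Group"
    "HOL-Computational_Algebra.Formal_Power_Series"
begin

unbundle fps_syntax

section \<open>Two groups of formal power series\<close>

definition comp_group :: "('a::field) fps monoid" where
  "comp_group =
    \<lparr> carrier = {F. F $ 0 = 0 \<and> F $ 1 \<noteq> 0},
      monoid.mult = (\<lambda>F K. F oo K),
      one = fps_X \<rparr>"

text \<open>The series \<open>f oo g\<close> is \<open>f(g(x))\<close>, so the second component below is \<open>K(F(x))\<close>.
  The second projection is thus an anti-homomorphism onto \<open>comp_group\<close>; powers and orders of
  elements do not depend on this choice.\<close>

definition riordan_group :: "('a::field fps \<times> 'a fps) monoid" where
  "riordan_group =
    \<lparr> carrier = {g. g $ 0 \<noteq> 0} \<times> carrier comp_group,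
      monoid.mult = (\<lambda>(g, F) (h, K). (g * (h oo F), K oo F)),
      one = (1, fps_X) \<rparr>"

text \<open>The constant \<open>group.ord\<close> is only specified under the assumption \<open>group\<close>, so the
  following two facts give it its meaning here: it is the least positive exponent that yields the
  identity, and 0 for elements of infinite order.\<close>

lemma group_comp_group: "group (comp_group :: 'a::field fps monoid)"
proof (rule groupI)
  fix F :: "'a fps" assume "F \<in> carrier comp_group"
  then have F: "F $ 0 = 0" "F $ 1 \<noteq> 0" by (auto simp: comp_group_def)
  have inv: "fps_inv F oo F = fps_X" using F by (rule fps_inv)
  have inv0: "fps_inv F $ 0 = 0" by (simp add: fps_inv_def)
  have "(fps_inv F oo F) $ 1 = fps_inv F $ 1 * F $ 1"
    by (simp add: fps_compose_nth inv0)
  then have "fps_inv F $ 1 \<noteq> 0" using inv by auto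
  with inv0 inv show "\<exists>K\<in>carrier comp_group. K \<otimes>\<^bsub>comp_group\<^esub> F = \<one>\<^bsub>comp_group\<^esub>"
    by (auto simp: comp_group_def)
qed (auto simp: comp_group_def fps_compose_nth fps_compose_assoc)

lemma group_riordan_group: "group (riordan_group :: ('a::field fps \<times> 'a fps) monoid)"
proof (rule groupI)
  interpret C: group "comp_group :: 'a fps monoid" by (rule group_comp_group)
  fix p :: "'a fps \<times> 'a fps" assume "p \<in> carrier riordan_group"
  then obtain g F where p: "p = (g, F)" and g: "g $ 0 \<noteq> 0" and F: "F \<in> carrier comp_group"
    by (auto simp: riordan_group_def)
  define K where "K = inv\<^bsub>comp_group\<^esub> F"
  have K: "K \<in> carrier comp_group" "F oo K = fps_X"
    using C.inv_closed[OF F] C.r_inv[OF F] by (simp_all add: K_def comp_group_def)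
  have "inverse (g oo K) * (g oo K) = 1"
    using g by (intro inverse_mult_eq_1) simp
  then have "(inverse (g oo K), K) \<otimes>\<^bsub>riordan_group\<^esub> p = \<one>\<^bsub>riordan_group\<^esub>"
    using K by (simp add: riordan_group_def p)
  moreover have "(inverse (g oo K), K) \<in> carrier riordan_group"
    using K g by (simp add: riordan_group_def)
  ultimately show "\<exists>q\<in>carrier riordan_group. q \<otimes>\<^bsub>riordan_group\<^esub> p = \<one>\<^bsub>riordan_group\<^esub>"
    by blast
qed (auto simp: riordan_group_def comp_group_def fps_compose_nth fps_compose_assoc
      fps_compose_mult_distrib mult.assoc)

lemma riordan_ord_pos_iff:
  assumes "p \<in> carrier riordan_group"
  shows "0 < group.ord riordan_group p
    \<longleftrightarrow> (\<exists>n::nat. n > 0 \<and> p [^]\<^bsub>riordan_group\<^esub> n = \<one>\<^bsub>riordan_group\<^esub>)"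
  using group.ord_eq_0[OF group_riordan_group assms] by auto

section \<open>Roots of power series\<close>

definition fps_root :: "nat \<Rightarrow> 'a::field fps \<Rightarrow> 'a fps" where
  "fps_root m u = (THE v. v $ 0 = 1 \<and> v ^ m = u)"

lemma fps_root_ex1:
  fixes u :: "'a::field_char_0 fps"
  assumes "m > 0" "u $ 0 = 1"
  shows "\<exists>!v. v $ 0 = 1 \<and> v ^ m = u"
proof -
  obtain k where m: "m = Suc k" using assms(1) gr0_implies_Suc by blast
  have "v ^ m = u \<longleftrightarrow> v = fps_radical (\<lambda>_ _. 1) m u" if "v $ 0 = 1" for v
    unfolding m by (rule radical_unique) (use that assms in auto)
  moreover have "fps_radical (\<lambda>_ _. 1) m u $ 0 = 1" by (simp add: m)
  ultimately show ?thesis by blast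
qed

lemma fps_root:
  fixes u :: "'a::field_char_0 fps"
  assumes "m > 0" "u $ 0 = 1"
  shows "fps_root m u $ 0 = 1" "fps_root m u ^ m = u"
  using theI'[OF fps_root_ex1[OF assms]] by (auto simp: fps_root_def)

section \<open>Riordan matrices acting on column vectors\<close>

definition riordan_matrix :: "'a::field fps \<times> 'a fps \<Rightarrow> nat \<Rightarrow> nat \<Rightarrow> 'a" where
  "riordan_matrix = (\<lambda>(g, F) n j. (g * F ^ j) $ n)"

lemma riordan_matrix_lower_triangular:
  assumes "p \<in> carrier riordan_group" "n < j"
  shows "riordan_matrix p n j = 0"
proof -
  obtain g F where p: "p = (g, F)" by (cases p)
  then have "F $ 0 = 0" using assms(1) by (auto simp: riordan_group_def comp_group_def)
  then have "\<forall>i\<le>n. F ^ j $ i = 0" using assms(2) startsby_zero_power_prefix by fastforce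
  then show ?thesis by (simp add: p riordan_matrix_def fps_mult_nth)
qed

text \<open>Only for lower triangular \<open>D\<close>: row \<open>n\<close> has no nonzero entry beyond column \<open>n\<close>.\<close>

definition lower_mat_vec :: "(nat \<Rightarrow> nat \<Rightarrow> 'a::field) \<Rightarrow> (nat \<Rightarrow> 'a) \<Rightarrow> nat \<Rightarrow> 'a" where
  "lower_mat_vec D v = (\<lambda>n. \<Sum>j\<le>n. D n j * v j)"

definition is_eigenvector :: "(nat \<Rightarrow> nat \<Rightarrow> 'a::field) \<Rightarrow> 'a \<Rightarrow> (nat \<Rightarrow> 'a) \<Rightarrow> bool" where
  "is_eigenvector D lam v \<longleftrightarrow> v \<noteq> (\<lambda>_. 0) \<and> lower_mat_vec D v = (\<lambda>n. lam * v n)"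

definition gen_fun :: "(nat \<Rightarrow> 'a::field) \<Rightarrow> 'a fps" where
  "gen_fun v = Abs_fps v"

end

theory Submission
  imports Defs
begin

text \<open>
  By the column description of a Riordan matrix, \<open>(g, F)\<close> sends the vector with generating
  function \<open>h\<close> to the one with generating function \<open>g * (h oo F)\<close>
  (\<open>gen_fun_lower_mat_vec\<close>), so the claim is the functional equation
  \<open>ghat * (h oo F) = h\<close>.

  Let \<open>u\<close> be the \<open>b\<close>-th root of \<open>ghat\<close> and write \<open>u\<^sub>i\<close> for \<open>u\<close> composed with the \<open>i\<close>-th
  iterate of \<open>F\<close>. Then \<open>h\<close> is the product of the \<open>u\<^sub>i\<^sup>b\<^sup>-\<^sup>1\<^sup>-\<^sup>i\<close>, composition with \<open>F\<close> shifts the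
  indices by one, and the factor \<open>ghat = u\<^sub>0\<^sup>b\<close> is exactly the one that the shift leaves out.
  The exponent of every \<open>u\<^sub>i\<close> thus goes up by one, and \<open>ghat * (h oo F)\<close> is \<open>h\<close> times the norm
  \<open>u\<^sub>0 * \<dots> * u\<^sub>b\<^sub>-\<^sub>1\<close> (\<open>staircase_prod_compose\<close>).

  Finite order of \<open>(g, F)\<close> forces this norm to be \<open>1\<close> (\<open>norm_of_root_eq_1\<close>). The first
  component of a power of \<open>(g, F)\<close> is a product of the composites of \<open>g\<close> with the iterates of
  \<open>F\<close>; along a multiple of \<open>b\<close> the iterates repeat with period \<open>b\<close>, so that this product is a
  constant times a positive power of the norm. The norm has constant term \<open>1\<close>, and in
  characteristic \<open>0\<close> the only such series with a power equal to \<open>1\<close> is \<open>1\<close>.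

  Both parts are instances of \<open>eigenvector_of_iterate_eq_X\<close>, where \<open>b\<close> is any positive exponent
  for which the \<open>b\<close>-th iterate of \<open>F\<close> is \<open>x\<close>: the first with \<open>b\<close> the order of \<open>F\<close>, the second
  with \<open>b = 2\<close>.
\<close>

section \<open>Riordan matrices as operators on generating functions\<close>

lemma gen_fun_lower_mat_vec:
  fixes g F :: "'a::field fps"
  assumes "F $ 0 = 0"
  shows "gen_fun (lower_mat_vec (riordan_matrix (g, F)) v) = g * (gen_fun v oo F)"
proof (rule fps_ext)
  fix n
  have vanish: "(F ^ j) $ m = 0" if "m < j" for m j
    using startsby_zero_power_prefix[OF assms] that by blast
  \<comment> \<open>Row \<open>m\<close> of the composition involves only \<open>j \<le> m\<close>; extending it to \<open>j \<le> n\<close> makes the range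
    independent of \<open>m\<close>, so that the two sums can be exchanged.\<close>
  have comp: "(gen_fun v oo F) $ m = (\<Sum>j\<le>n. v j * (F ^ j) $ m)" if "m \<le> n" for m
    unfolding fps_compose_nth gen_fun_def using that
    by (intro sum.mono_neutral_cong_left) (auto simp: vanish)
  have "(g * (gen_fun v oo F)) $ n = (\<Sum>i\<le>n. \<Sum>j\<le>n. g $ i * (v j * (F ^ j) $ (n - i)))"
    by (simp add: fps_mult_nth comp sum_distrib_left atLeast0AtMost)
  also have "\<dots> = (\<Sum>j\<le>n. \<Sum>i\<le>n. g $ i * (v j * (F ^ j) $ (n - i)))"
    by (rule sum.swap)
  also have "\<dots> = (\<Sum>j\<le>n. riordan_matrix (g, F) n j * v j)"
    by (simp add: riordan_matrix_def fps_mult_nth sum_distrib_left atLeast0AtMost mult_ac)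
  finally show "gen_fun (lower_mat_vec (riordan_matrix (g, F)) v) $ n = (g * (gen_fun v oo F)) $ n"
    by (simp add: gen_fun_def lower_mat_vec_def)
qed

lemma is_eigenvector_nth:
  fixes g F h :: "'a::field fps"
  assumes "F $ 0 = 0" "h \<noteq> 0" "g * (h oo F) = fps_const lam * h"
  shows "is_eigenvector (riordan_matrix (g, F)) lam (fps_nth h)"
proof -
  have "gen_fun (fps_nth h) = h" by (simp add: gen_fun_def fps_nth_inverse)
  then have "gen_fun (lower_mat_vec (riordan_matrix (g, F)) (fps_nth h)) = fps_const lam * h"
    using assms by (simp add: gen_fun_lower_mat_vec)
  then have "lower_mat_vec (riordan_matrix (g, F)) (fps_nth h) = (\<lambda>n. lam * h $ n)"
    by (simp add: gen_fun_def fps_eq_iff fun_eq_iff)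
  moreover have "fps_nth h \<noteq> (\<lambda>_. 0)" using assms(2) by (auto simp: fps_eq_iff)
  ultimately show ?thesis by (simp add: is_eigenvector_def)
qed

section \<open>Iterates and powers\<close>

lemma iterate_nth_0:
  assumes "F \<in> carrier comp_group"
  shows "(F [^]\<^bsub>comp_group\<^esub> (n::nat)) $ 0 = 0"
  using monoid.nat_pow_closed[OF group.is_monoid[OF group_comp_group] assms, of n]
  by (simp add: comp_group_def)

lemma iterate_add:
  assumes "F \<in> carrier comp_group"
  shows "F [^]\<^bsub>comp_group\<^esub> (m + n :: nat) = F [^]\<^bsub>comp_group\<^esub> m oo F [^]\<^bsub>comp_group\<^esub> n"
  using monoid.nat_pow_mult[OF group.is_monoid[OF group_comp_group] assms, of m n]
  by (simp add: comp_group_def)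

lemma iterate_Suc: "F [^]\<^bsub>comp_group\<^esub> (Suc n) = F [^]\<^bsub>comp_group\<^esub> n oo F"
  by (simp add: comp_group_def)

lemma one_comp_group: "\<one>\<^bsub>comp_group\<^esub> = fps_X"
  by (simp add: comp_group_def)

text \<open>
  The multiplication of the group composes second components in reversed order; since powers of
  one element commute, the second component is nevertheless the iterate itself.
\<close>

lemma riordan_pow:
  fixes g F :: "'a::field fps"
  assumes "F \<in> carrier comp_group"
  shows "(g, F) [^]\<^bsub>riordan_group\<^esub> (n::nat)
    = (\<Prod>i<n. g oo F [^]\<^bsub>comp_group\<^esub> i, F [^]\<^bsub>comp_group\<^esub> n)"
proof (induction n)
  case 0
  show ?case by (simp add: riordan_group_def comp_group_def)
next
  case (Suc n)
  have "F oo F [^]\<^bsub>comp_group\<^esub> n = F [^]\<^bsub>comp_group\<^esub> (Suc n)"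
    using monoid.nat_pow_Suc2[OF group.is_monoid[OF group_comp_group] assms, of n]
    by (simp add: comp_group_def)
  moreover have "(g, F) [^]\<^bsub>riordan_group\<^esub> (Suc n) = (g, F) [^]\<^bsub>riordan_group\<^esub> n \<otimes>\<^bsub>riordan_group\<^esub> (g, F)"
    by (rule nat_pow_Suc)
  ultimately show ?case
    using Suc.IH by (simp add: riordan_group_def)
qed

section \<open>The norm of a root\<close>

lemma fps_prod_zeroth:
  fixes f :: "'b \<Rightarrow> 'a::comm_ring_1 fps"
  shows "(\<Prod>i\<in>A. f i) $ 0 = (\<Prod>i\<in>A. f i $ 0)"
  by (induction A rule: infinite_finite_induct) auto

lemma fps_eq_1_if_power_eq_1:
  fixes v :: "'a::field_char_0 fps"
  assumes "m > 0" "v $ 0 = 1" "v ^ m = 1"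
  shows "v = 1"
  using fps_root_ex1[OF assms(1), of "1 :: 'a fps"] assms by auto

lemma prod_periodic:
  fixes f :: "nat \<Rightarrow> 'a::comm_monoid_mult"
  assumes "\<And>i. f (i + b) = f i"
  shows "(\<Prod>i<n * b. f i) = (\<Prod>i<b. f i) ^ n"
proof -
  have shift: "f (i + k * b) = f i" for i k
  proof (induction k)
    case (Suc k)
    have "f (i + Suc k * b) = f ((i + k * b) + b)" by (simp add: add_ac)
    then show ?case using Suc by (simp only: assms)
  qed simp
  show ?thesis
  proof (induction n)
    case (Suc n)
    have "(\<Prod>i<Suc n * b. f i) = (\<Prod>i<n * b. f i) * (\<Prod>i<b. f (i + n * b))"
      using prod.nat_group[of f b "Suc n"] prod.nat_group[of f b n]
      by (simp add: prod.shift_bounds_nat_ivl[of f 0 "n * b" b, simplified] atLeast0LessThan add_ac)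
    then show ?case using Suc by (simp only: shift power_Suc2)
  qed simp
qed

text \<open>
  If the \<open>n\<close>-th power of \<open>(g, F)\<close> is the identity, then so is the \<open>(n * b)\<close>-th, and its first
  component is \<open>c\<^sup>n\<^sup>b\<close> times the \<open>(b * n)\<close>-th power of the norm. Comparing constant terms
  removes the scalar.
\<close>

lemma norm_of_root_eq_1:
  fixes g F u :: "'a::field_char_0 fps" and b n :: nat
  assumes gF: "(g, F) \<in> carrier riordan_group"
    and b: "b > 0" "F [^]\<^bsub>comp_group\<^esub> b = fps_X"
    and n: "n > 0" "(g, F) [^]\<^bsub>riordan_group\<^esub> n = \<one>\<^bsub>riordan_group\<^esub>"
    and u: "u $ 0 = 1" "g = fps_const c * u ^ b"
  shows "(\<Prod>i<b. u oo F [^]\<^bsub>comp_group\<^esub> i) = 1"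
proof -
  let ?u = "\<lambda>i. u oo F [^]\<^bsub>comp_group\<^esub> (i::nat)"
  have F: "F \<in> carrier comp_group" using gF by (simp add: riordan_group_def)
  define Q where "Q = (\<Prod>i<b. ?u i)"
  have F0: "(F [^]\<^bsub>comp_group\<^esub> i) $ 0 = 0" for i :: nat by (rule iterate_nth_0[OF F])
  have Q0: "Q $ 0 = 1" by (simp add: Q_def fps_prod_zeroth u)
  have period: "?u (i + b) = ?u i" for i by (simp add: iterate_add[OF F] b)
  have gi: "g oo F [^]\<^bsub>comp_group\<^esub> i = fps_const c * ?u i ^ b" for i :: nat
    by (simp add: u(2) fps_compose_mult_distrib[OF F0] fps_compose_power[OF F0])
  have "(g, F) [^]\<^bsub>riordan_group\<^esub> (n * b) = \<one>\<^bsub>riordan_group\<^esub>"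
    using monoid.nat_pow_pow[OF group.is_monoid[OF group_riordan_group] gF, of n b]
    by (simp add: n monoid.nat_pow_one[OF group.is_monoid[OF group_riordan_group]])
  then have "(\<Prod>i<n * b. g oo F [^]\<^bsub>comp_group\<^esub> i) = 1"
    by (simp add: riordan_pow[OF F]) (simp add: riordan_group_def)
  then have "(\<Prod>i<n * b. fps_const c * ?u i ^ b) = 1" by (simp only: gi)
  then have eq: "fps_const (c ^ (n * b)) * Q ^ (b * n) = 1"
    using prod_periodic[of ?u b n, OF period]
    by (simp add: prod.distrib prod_power_distrib[symmetric] fps_const_power Q_def
        power_mult[symmetric] mult.commute)
  then have "(fps_const (c ^ (n * b)) * Q ^ (b * n)) $ 0 = 1" by simp
  then have "c ^ (n * b) = 1" by (simp add: fps_power_zeroth Q0)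
  with eq have "Q ^ (b * n) = 1" by simp
  then show ?thesis unfolding Q_def[symmetric]
    using fps_eq_1_if_power_eq_1[of "b * n" Q] b n Q0 by simp
qed

section \<open>The eigenvector\<close>

text \<open>
  Composition with \<open>F\<close> moves the factor with index \<open>i\<close> and exponent \<open>b - 1 - i\<close> to index
  \<open>i + 1\<close>; in terms of its new index \<open>j\<close> the exponent is \<open>b - j\<close>, one more than before, and
  \<open>u ^ b\<close> supplies the missing case \<open>j = 0\<close>.
\<close>

lemma staircase_prod_compose:
  fixes u F :: "'a::field fps"
  assumes F: "F \<in> carrier comp_group" and "b > 0"
  defines "h \<equiv> \<Prod>i<b - 1. (u oo F [^]\<^bsub>comp_group\<^esub> i) ^ (b - 1 - i)"
  shows "u ^ b * (h oo F) = h * (\<Prod>i<b. u oo F [^]\<^bsub>comp_group\<^esub> i)"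
proof -
  let ?u = "\<lambda>i. u oo F [^]\<^bsub>comp_group\<^esub> (i::nat)"
  obtain c where c: "b = Suc c" using \<open>b > 0\<close> gr0_implies_Suc by blast
  have F0: "F $ 0 = 0" using F by (simp add: comp_group_def)
  have step: "?u i oo F = ?u (Suc i)" for i
    by (simp only: iterate_Suc fps_compose_assoc[OF F0 iterate_nth_0[OF F]])
  have "h oo F = (\<Prod>i<c. ?u (Suc i) ^ (c - i))"
    by (simp add: h_def c fps_compose_prod_distrib[OF F0] fps_compose_power[OF F0, symmetric] step
        del: nat_pow_Suc)
  then have "u ^ b * (h oo F) = (\<Prod>j<Suc c. ?u j ^ (Suc c - j))"
    by (simp add: c prod.lessThan_Suc_shift one_comp_group del: prod.lessThan_Suc nat_pow_Suc)
  also have "\<dots> = (\<Prod>j<Suc c. ?u j ^ (c - j) * ?u j)"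
    by (intro prod.cong) (auto simp: Suc_diff_le mult.commute)
  also have "\<dots> = (\<Prod>j<Suc c. ?u j ^ (c - j)) * (\<Prod>j<Suc c. ?u j)"
    by (rule prod.distrib)
  \<comment> \<open>The factor with \<open>j = c\<close> has exponent \<open>0\<close>, which is why \<open>h\<close> omits it.\<close>
  also have "(\<Prod>j<Suc c. ?u j ^ (c - j)) = h" by (simp add: h_def c)
  finally show ?thesis by (simp only: c)
qed

text \<open>
  Any \<open>b > 0\<close> whose iterate is \<open>x\<close> is admitted, so that \<open>b = 2\<close> can be used for every
  involution, including those whose second component is already \<open>x\<close>.
\<close>

lemma eigenvector_of_iterate_eq_X:
  fixes g F :: "'a::field_char_0 fps" and b n :: nat
  assumes gF: "(g, F) \<in> carrier riordan_group"
    and b: "b > 0" "F [^]\<^bsub>comp_group\<^esub> b = fps_X"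
    and n: "n > 0" "(g, F) [^]\<^bsub>riordan_group\<^esub> n = \<one>\<^bsub>riordan_group\<^esub>"
  defines "h \<equiv> \<Prod>i<b - 1.
    (fps_root b (fps_const (1 / g $ 0) * g) oo F [^]\<^bsub>comp_group\<^esub> i) ^ (b - 1 - i)"
  shows "\<exists>v. is_eigenvector (riordan_matrix (g, F)) (g $ 0) v \<and> gen_fun v = h"
proof -
  define u where "u = fps_root b (fps_const (1 / g $ 0) * g)"
  have g0: "g $ 0 \<noteq> 0" and F: "F \<in> carrier comp_group"
    using gF by (auto simp: riordan_group_def)
  have F0: "F $ 0 = 0" using F by (simp add: comp_group_def)
  have u0: "u $ 0 = 1" and ub: "u ^ b = fps_const (1 / g $ 0) * g"
    using fps_root[OF b(1), of "fps_const (1 / g $ 0) * g"] g0 by (simp_all add: u_def)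
  have g: "g = fps_const (g $ 0) * u ^ b"
    using g0 by (simp add: ub mult.assoc[symmetric])
  have "u ^ b * (h oo F) = h"
    using staircase_prod_compose[OF F b(1), of u] norm_of_root_eq_1[OF gF b n u0 g]
    by (simp add: h_def u_def)
  then have "g * (h oo F) = fps_const (g $ 0) * h"
    by (subst g) (simp add: mult.assoc)
  moreover have "h $ 0 = 1"
    by (simp add: h_def u_def[symmetric] fps_prod_zeroth fps_power_zeroth u0)
  then have "h \<noteq> 0" by auto
  ultimately have "is_eigenvector (riordan_matrix (g, F)) (g $ 0) (fps_nth h)"
    using F0 by (intro is_eigenvector_nth)
  moreover have "gen_fun (fps_nth h) = h" by (simp add: gen_fun_def fps_nth_inverse)
  ultimately show ?thesis by blast
qed

theorem corollary5p3:
  fixes g F ghat :: "'a::field_char_0 fps"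
  assumes "(g, F) \<in> carrier riordan_group"
    and "ghat = fps_const (1 / g $ 0) * g"
  shows "(\<forall>b. 0 < group.ord riordan_group (g, F) \<and> b = group.ord comp_group F \<longrightarrow>
            (\<exists>v. is_eigenvector (riordan_matrix (g, F)) (g $ 0) v \<and>
                 gen_fun v =
                   (\<Prod>i<b - 1. (fps_root b ghat oo (F [^]\<^bsub>comp_group\<^esub> i)) ^ (b - 1 - i))))
       \<and> (group.ord riordan_group (g, F) = 2 \<longrightarrow>
            (\<exists>v. is_eigenvector (riordan_matrix (g, F)) (g $ 0) v \<and>
                 gen_fun v = fps_root 2 ghat))"
proof (intro conjI allI impI)
  have F: "F \<in> carrier comp_group" using assms(1) by (simp add: riordan_group_def)
  interpret R: group "riordan_group :: ('a fps \<times> 'a fps) monoid" by (rule group_riordan_group)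
  interpret C: group "comp_group :: 'a fps monoid" by (rule group_comp_group)
  let ?n = "R.ord (g, F)"
  have pow: "(g, F) [^]\<^bsub>riordan_group\<^esub> ?n = \<one>\<^bsub>riordan_group\<^esub>"
    by (rule R.pow_ord_eq_1[OF assms(1)])
  then have Fn: "F [^]\<^bsub>comp_group\<^esub> ?n = fps_X"
    by (simp add: riordan_pow[OF F]) (simp add: riordan_group_def)
  {
    fix b assume b: "0 < ?n \<and> b = C.ord F"
    have "F [^]\<^bsub>comp_group\<^esub> ?n = \<one>\<^bsub>comp_group\<^esub>" using Fn by (simp add: comp_group_def)
    then have "b > 0" using b C.ord_eq_0[OF F] by auto
    moreover have "F [^]\<^bsub>comp_group\<^esub> b = fps_X"
      using C.pow_ord_eq_1[OF F] b by (simp add: comp_group_def)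
    ultimately show "\<exists>v. is_eigenvector (riordan_matrix (g, F)) (g $ 0) v \<and>
        gen_fun v = (\<Prod>i<b - 1. (fps_root b ghat oo (F [^]\<^bsub>comp_group\<^esub> i)) ^ (b - 1 - i))"
      unfolding assms(2) using b pow
      by (intro eigenvector_of_iterate_eq_X[OF assms(1)]) auto
  next
    assume two: "?n = 2"
    \<comment> \<open>For \<open>b = 2\<close> the product has the single factor \<open>i = 0\<close>, whose iterate is \<open>x\<close>.\<close>
    have "(\<Prod>i<2 - 1. (fps_root 2 ghat oo (F [^]\<^bsub>comp_group\<^esub> i)) ^ (2 - 1 - i)) = fps_root 2 ghat"
      by (simp add: one_comp_group)
    then show "\<exists>v. is_eigenvector (riordan_matrix (g, F)) (g $ 0) v \<and> gen_fun v = fps_root 2 ghat"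
      using eigenvector_of_iterate_eq_X[OF assms(1) _ _ _ pow, of 2] two Fn
      by (simp only: assms(2))
  }
qed

end
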